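(* Let $(A,B,\varphi)$ be a crossed module of triassociative algebras over a field $\mathbb{K}$, with action of $B$ on $A$ given by $\mu_1^\dashv,\mu_1^\perp,\mu_1^\vdash:A\times B\to A$ and $\mu_2^\dashv,\mu_2^\perp,\mu_2^\vdash:B\times A\to A$. Define six trilinear maps, for $x,y,z\in A$ and $a,b,c\in B$, by $$m_1(x,a,b)=\mu_1^\dashv(x,a\perp b-b\perp a)-\mu_2^\vdash(a\perp b-b\perp a,x),$$ $$m_2(a,x,b)=\mu_2^\dashv(a,\mu_1^\perp(x,b)-\mu_2^\perp(b,x))-\mu_1^\vdash(\mu_1^\perp(x,b)-\mu_2^\perp(b,x),a),$$ $$m_3(a,b,x)=\mu_2^\dashv(a,\mu_2^\perp(b,x)-\mu_1^\perp(x,b))-\mu_1^\vdash(\mu_2^\perp(b,x)-\mu_1^\perp(x,b),a),$$ $$m'_1(c,y,z)=\mu_2^\dashv(c,y\perp z-z\perp y)-\mu_1^\vdash(y\perp z-z\perp y,c),$$ $$m'_2(y,c,z)=y\dashv(\mu_2^\perp(c,z)-\mu_1^\perp(z,c))-(\mu_2^\perp(c,z)-\mu_1^\perp(z,c))\vdash y,$$ $$m'_3(y,z,c)=y\dashv(\mu_1^\perp(z,c)-\mu_2^\perp(c,z))-(\mu_1^\perp(z,c)-\mu_2^\perp(c,z))\vdash y.$$ 1) (a) These maps define an action of the ternary Leibniz algebra $T(B)$ on the ternary Leibniz algebra $T(A)$. (b) With this action, $(T(A),T(B),\varphi)$ is a crossed module of ternary Leibniz algebras. 2) Moreover, if $(A',B',\varphi')$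 is another crossed module of triassociative algebras and $(\alpha,\beta)$ is a morphism of crossed modules of triassociative algebras from $(A,B,\varphi)$ to $(A',B',\varphi')$, then $(\alpha,\beta)$ is a morphism of crossed modules of ternary Leibniz algebras from $(T(A),T(B),\varphi)$ to $(T(A'),T(B'),\varphi')$ (the latter with the action defined by the same formulas from that of $B'$ on $A'$).
   Context: Triassociative algebras. A triassociative algebra over $\mathbb{K}$ is a $\mathbb{K}$-vector space $A$ with three bilinear products $\dashv,\perp,\vdash$ such that for all $x,y,z\in A$: (1) $(x\dashv y)\dashv z=x\dashv(y\dashv z)$; (2) $(x\vdash y)\vdash z=x\vdash(y\vdash z)$; (3) $(x\perp y)\perp z=x\perp(y\perp z)$; (4) $(x\dashv y)\dashv z=x\dashv(y\vdash z)$; (5) $(x\dashv y)\dashv z=x\dashv(y\perp z)$; (6) $(x\vdash y)\dashv z=x\vdash(y\dashv z)$; (7) $(x\dashv y)\vdash z=x\vdash(y\vdash z)$; (8) $(x\perp y)\vdash z=x\vdash(y\vdash z)$; (9) $(x\perp y)\dashv z=x\perp(y\dashv z)$; (10) $(x\dashv y)\perp z=x\perp(y\vdash z)$; (11) $(x\vdash y)\perp z=x\vdash(y\perp z)$. Morphisms are linear maps preserving the three products. An action of a triassociative algebra $B$ on a triassociative algebra $A$ consists of bilinear maps $\mu_1^\ast:A\times B\to A$, $\mu_2^\ast:B\times A\to A$ ($\ast=\dashv,\perp,\vdash$) satisfying the 66 equalities obtained from (1)–(11) by letting each of the three variables lie in $A$ or in $B$, not all three in the same algebra, where $u\ast v$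 means $u\ast_A v$ if $u,v\in A$, $u\ast_B v$ if $u,v\in B$, $\mu_1^\ast(u,v)$ if $u\in A,v\in B$, and $\mu_2^\ast(u,v)$ if $u\in B,v\in A$. A crossed module of triassociative algebras $(A,B,\varphi)$ is a morphism $\varphi:A\to B$ with an action of $B$ on $A$ such that for all $x,y\in A$, $a\in B$, $\ast\in\{\dashv,\perp,\vdash\}$: $\varphi\mu_1^\ast(x,a)=\varphi(x)\ast_B a$; $\varphi\mu_2^\ast(a,x)=a\ast_B\varphi(x)$; $\mu_1^\ast(x,\varphi(y))=x\ast_A y=\mu_2^\ast(\varphi(x),y)$. A morphism $(A,B,\varphi)\to(A',B',\varphi')$ of such crossed modules is a pair of triassociative morphisms $\alpha:A\to A'$, $\beta:B\to B'$ with $\varphi'\alpha=\beta\varphi$, $\alpha\mu_1^\ast(x,a)=\mu_1'^\ast(\alpha(x),\beta(a))$, $\alpha\mu_2^\ast(a,x)=\mu_2'^\ast(\beta(a),\alpha(x))$. Ternary Leibniz algebras. A (right) ternary Leibniz algebra is a vector space with a trilinear bracket satisfying $[[x,y,z],t,u]=[x,y,[z,t,u]]+[x,[y,t,u],z]+[[x,t,u],y,z]$. Morphisms are linear maps preserving the bracket. For a triassociative algebra $A$, $T(A)$ denotes the ternary Leibniz algebra on the vector space $A$ with bracket $[x,y,z]=x\dashv(y\perp z-z\perp y)-(y\perp z-z\perp y)\vdash x$ (it is known that this is a ternary Leibniz algebra). An action of a ternary Leibniz algebra $\mathcal P$ on a ternary Leibniz algebra $\mathcal L$ consists of six trilinear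 maps $m_1:\mathcal L\times\mathcal P\times\mathcal P\to\mathcal L$, $m_2:\mathcal P\times\mathcal L\times\mathcal P\to\mathcal L$, $m_3:\mathcal P\times\mathcal P\times\mathcal L\to\mathcal L$, $m'_1:\mathcal P\times\mathcal L\times\mathcal L\to\mathcal L$, $m'_2:\mathcal L\times\mathcal P\times\mathcal L\to\mathcal L$, $m'_3:\mathcal L\times\mathcal L\times\mathcal P\to\mathcal L$ satisfying the 30 equalities obtained from the ternary Leibniz identity by letting each of its five variables lie in $\mathcal L$ or in $\mathcal P$, not all five in the same algebra, where a bracket of three elements is the bracket of $\mathcal L$ or $\mathcal P$ if all three lie in the same algebra and otherwise is the unique one of the six maps with matching domain. A crossed module of ternary Leibniz algebras $(\mathcal L,\mathcal P,\varphi)$ is a morphism $\varphi:\mathcal L\to\mathcal P$ with an action of $\mathcal P$ on $\mathcal L$ such that, for all $l,l_i\in\mathcal L$, $p,p_i\in\mathcal P$: (i) $\varphi m_1(l,p_1,p_2)=[\varphi(l),p_1,p_2]$, $\varphi m_2(p_1,l,p_2)=[p_1,\varphi(l),p_2]$, $\varphi m_3(p_1,p_2,l)=[p_1,p_2,\varphi(l)]$, $\varphi m'_1(p,l_1,l_2)=[p,\varphi(l_1),\varphi(l_2)]$, $\varphi m'_2(l_1,p,l_2)=[\varphi(l_1),p,\varphi(l_2)]$, $\varphi m'_3(l_1,l_2,p)=[\varphi(l_1),\varphi(l_2),p]$; (ii) $[l_1,l_2,l_3]=m'_1(\varphi(l_1),l_2,l_3)=m'_2(l_1,\varphi(l_2),l_3)=m'_3(l_1,l_2,\varphi(l_3))$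 and $m_3(\varphi(l_1),\varphi(l_2),l_3)=m_2(\varphi(l_1),l_2,\varphi(l_3))=m_1(l_1,\varphi(l_2),\varphi(l_3))$; (iii) $m'_3(l_1,l_2,p)=m_2(\varphi(l_1),l_2,p)=m_1(l_1,\varphi(l_2),p)$, $m'_2(l_1,p,l_2)=m_3(\varphi(l_1),p,l_2)=m_1(l_1,p,\varphi(l_2))$, $m'_1(p,l_1,l_2)=m_3(p,\varphi(l_1),l_2)=m_2(p,l_1,\varphi(l_2))$. A morphism of crossed modules of ternary Leibniz algebras $(\mathcal L,\mathcal P,\varphi)\to(\mathcal L',\mathcal P',\varphi')$ is a pair of morphisms $\alpha:\mathcal L\to\mathcal L'$, $\beta:\mathcal P\to\mathcal P'$ of ternary Leibniz algebras with $\varphi'\alpha=\beta\varphi$ such that each of the six action maps is carried to the corresponding one by applying $\alpha$ to arguments in $\mathcal L$ and $\beta$ to arguments in $\mathcal P$ (e.g. $\alpha m_1(l,p_1,p_2)=n_1(\alpha(l),\beta(p_1),\beta(p_2))$, where $n_i,n_i'$ are the action maps of $\mathcal P'$ on $\mathcal L'$). *)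

theory Defs
  imports Main "HOL.Vector_Spaces"
begin

text \<open>
  Vector spaces are those of the theory \<^theory>\<open>HOL.Vector_Spaces\<close>: the underlying abelian group is
  a type of class \<^class>\<open>ab_group_add\<close>, with an explicit scalar multiplication over a type of
  class \<^class>\<open>field\<close>. Since \<open>Vector_Spaces.linear s s' f\<close> includes \<open>vector_space s\<close> and
  \<open>vector_space s'\<close>, multilinear maps below are maps between vector spaces.
\<close>

definition bilinear_map ::
  "('k::field \<Rightarrow> 'a::ab_group_add \<Rightarrow> 'a) \<Rightarrow> ('k \<Rightarrow> 'b::ab_group_add \<Rightarrow> 'b) \<Rightarrow>
   ('k \<Rightarrow> 'c::ab_group_add \<Rightarrow> 'c) \<Rightarrow> ('a \<Rightarrow> 'b \<Rightarrow> 'c) \<Rightarrow> bool" where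
  "bilinear_map s1 s2 s f \<longleftrightarrow>
     (\<forall>y. Vector_Spaces.linear s1 s (\<lambda>x. f x y)) \<and>
     (\<forall>x. Vector_Spaces.linear s2 s (\<lambda>y. f x y))"

definition trilinear_map ::
  "('k::field \<Rightarrow> 'a::ab_group_add \<Rightarrow> 'a) \<Rightarrow> ('k \<Rightarrow> 'b::ab_group_add \<Rightarrow> 'b) \<Rightarrow>
   ('k \<Rightarrow> 'c::ab_group_add \<Rightarrow> 'c) \<Rightarrow> ('k \<Rightarrow> 'd::ab_group_add \<Rightarrow> 'd) \<Rightarrow>
   ('a \<Rightarrow> 'b \<Rightarrow> 'c \<Rightarrow> 'd) \<Rightarrow> bool" where
  "trilinear_map s1 s2 s3 s f \<longleftrightarrow>
     (\<forall>y z. Vector_Spaces.linear s1 s (\<lambda>x. f x y z)) \<and>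
     (\<forall>x z. Vector_Spaces.linear s2 s (\<lambda>y. f x y z)) \<and>
     (\<forall>x y. Vector_Spaces.linear s3 s (\<lambda>z. f x y z))"


section \<open>Triassociative algebras\<close>

text \<open>\<open>Dashv\<close>, \<open>Perp\<close>, \<open>Vdash\<close> index the products \<open>\<stileturn>\<close>, \<open>\<bottom>\<close>, \<open>\<turnstile>\<close>.\<close>

datatype tri_op = Dashv | Perp | Vdash

record ('k, 'a) tri_alg =
  tri_scale :: "'k \<Rightarrow> 'a \<Rightarrow> 'a"
  tri_prod :: "tri_op \<Rightarrow> 'a \<Rightarrow> 'a \<Rightarrow> 'a"

text \<open>
  The eleven identities for one triple of elements. The carrier type is arbitrary, so that the
  same list serves for algebras and, with a disjoint sum as carrier, for actions.
\<close>

definition tri_laws :: "(tri_op \<Rightarrow> 'c \<Rightarrow> 'c \<Rightarrow> 'c) \<Rightarrow> 'c \<Rightarrow> 'c \<Rightarrow> 'c \<Rightarrow> bool" where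
  "tri_laws p x y z \<longleftrightarrow>
     p Dashv (p Dashv x y) z = p Dashv x (p Dashv y z) \<and>
     p Vdash (p Vdash x y) z = p Vdash x (p Vdash y z) \<and>
     p Perp (p Perp x y) z = p Perp x (p Perp y z) \<and>
     p Dashv (p Dashv x y) z = p Dashv x (p Vdash y z) \<and>
     p Dashv (p Dashv x y) z = p Dashv x (p Perp y z) \<and>
     p Dashv (p Vdash x y) z = p Vdash x (p Dashv y z) \<and>
     p Vdash (p Dashv x y) z = p Vdash x (p Vdash y z) \<and>
     p Vdash (p Perp x y) z = p Vdash x (p Vdash y z) \<and>
     p Dashv (p Perp x y) z = p Perp x (p Dashv y z) \<and>
     p Perp (p Dashv x y) z = p Perp x (p Vdash y z) \<and>
     p Perp (p Vdash x y) z = p Vdash x (p Perp y z)"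

definition triassociative_algebra :: "('k::field, 'a::ab_group_add) tri_alg \<Rightarrow> bool" where
  "triassociative_algebra A \<longleftrightarrow>
     vector_space (tri_scale A) \<and>
     (\<forall>s. bilinear_map (tri_scale A) (tri_scale A) (tri_scale A) (tri_prod A s)) \<and>
     (\<forall>x y z. tri_laws (tri_prod A) x y z)"

definition tri_morphism ::
  "('k::field, 'a::ab_group_add) tri_alg \<Rightarrow> ('k, 'b::ab_group_add) tri_alg \<Rightarrow> ('a \<Rightarrow> 'b) \<Rightarrow> bool"
where
  "tri_morphism A B f \<longleftrightarrow>
     triassociative_algebra A \<and> triassociative_algebra B \<and>
     Vector_Spaces.linear (tri_scale A) (tri_scale B) f \<and>
     (\<forall>s x y. f (tri_prod A s x y) = tri_prod B s (f x) (f y))"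

record ('a, 'b) tri_act =
  mu1 :: "tri_op \<Rightarrow> 'a \<Rightarrow> 'b \<Rightarrow> 'a"
  mu2 :: "tri_op \<Rightarrow> 'b \<Rightarrow> 'a \<Rightarrow> 'a"

text \<open>
  Elements tagged \<open>Inl\<close> lie in \<open>A\<close>, those tagged \<open>Inr\<close> lie in \<open>B\<close>; the product of two elements
  is chosen according to where they lie.
\<close>

fun mixed_prod ::
  "('k, 'a) tri_alg \<Rightarrow> ('k, 'b) tri_alg \<Rightarrow> ('a, 'b) tri_act \<Rightarrow>
   tri_op \<Rightarrow> 'a + 'b \<Rightarrow> 'a + 'b \<Rightarrow> 'a + 'b" where
  "mixed_prod A B \<mu> s (Inl x) (Inl y) = Inl (tri_prod A s x y)"
| "mixed_prod A B \<mu> s (Inr a) (Inr b) = Inr (tri_prod B s a b)"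
| "mixed_prod A B \<mu> s (Inl x) (Inr b) = Inl (mu1 \<mu> s x b)"
| "mixed_prod A B \<mu> s (Inr a) (Inl y) = Inl (mu2 \<mu> s a y)"

definition not_all_same_side :: "('a + 'b) set \<Rightarrow> bool" where
  "not_all_same_side S \<longleftrightarrow> (\<exists>u\<in>S. isl u) \<and> (\<exists>u\<in>S. \<not> isl u)"

text \<open>\<open>tri_action B A \<mu>\<close>: \<open>B\<close> acts on \<open>A\<close> by \<open>\<mu>\<close>.\<close>

definition tri_action ::
  "('k::field, 'b::ab_group_add) tri_alg \<Rightarrow> ('k, 'a::ab_group_add) tri_alg \<Rightarrow>
   ('a, 'b) tri_act \<Rightarrow> bool" where
  "tri_action B A \<mu> \<longleftrightarrow>
     triassociative_algebra B \<and> triassociative_algebra A \<and>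
     (\<forall>s. bilinear_map (tri_scale A) (tri_scale B) (tri_scale A) (mu1 \<mu> s)) \<and>
     (\<forall>s. bilinear_map (tri_scale B) (tri_scale A) (tri_scale A) (mu2 \<mu> s)) \<and>
     (\<forall>u v w. not_all_same_side {u, v, w} \<longrightarrow> tri_laws (mixed_prod A B \<mu>) u v w)"

definition tri_crossed_module ::
  "('k::field, 'a::ab_group_add) tri_alg \<Rightarrow> ('k, 'b::ab_group_add) tri_alg \<Rightarrow>
   ('a, 'b) tri_act \<Rightarrow> ('a \<Rightarrow> 'b) \<Rightarrow> bool" where
  "tri_crossed_module A B \<mu> \<phi> \<longleftrightarrow>
     tri_morphism A B \<phi> \<and> tri_action B A \<mu> \<and>
     (\<forall>s x a. \<phi> (mu1 \<mu> s x a) = tri_prod B s (\<phi> x) a) \<and>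
     (\<forall>s a x. \<phi> (mu2 \<mu> s a x) = tri_prod B s a (\<phi> x)) \<and>
     (\<forall>s x y. mu1 \<mu> s x (\<phi> y) = tri_prod A s x y) \<and>
     (\<forall>s x y. tri_prod A s x y = mu2 \<mu> s (\<phi> x) y)"

definition tri_crossed_morphism ::
  "('k::field, 'a::ab_group_add) tri_alg \<Rightarrow> ('k, 'b::ab_group_add) tri_alg \<Rightarrow>
   ('a, 'b) tri_act \<Rightarrow> ('a \<Rightarrow> 'b) \<Rightarrow>
   ('k, 'c::ab_group_add) tri_alg \<Rightarrow> ('k, 'd::ab_group_add) tri_alg \<Rightarrow>
   ('c, 'd) tri_act \<Rightarrow> ('c \<Rightarrow> 'd) \<Rightarrow> ('a \<Rightarrow> 'c) \<Rightarrow> ('b \<Rightarrow> 'd) \<Rightarrow> bool" where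
  "tri_crossed_morphism A B \<mu> \<phi> A' B' \<mu>' \<phi>' \<alpha> \<beta> \<longleftrightarrow>
     tri_crossed_module A B \<mu> \<phi> \<and> tri_crossed_module A' B' \<mu>' \<phi>' \<and>
     tri_morphism A A' \<alpha> \<and> tri_morphism B B' \<beta> \<and>
     (\<forall>x. \<phi>' (\<alpha> x) = \<beta> (\<phi> x)) \<and>
     (\<forall>s x a. \<alpha> (mu1 \<mu> s x a) = mu1 \<mu>' s (\<alpha> x) (\<beta> a)) \<and>
     (\<forall>s a x. \<alpha> (mu2 \<mu> s a x) = mu2 \<mu>' s (\<beta> a) (\<alpha> x))"


section \<open>Ternary Leibniz algebras\<close>

record ('k, 'l) tern_alg =
  tern_scale :: "'k \<Rightarrow> 'l \<Rightarrow> 'l"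
  tern_bracket :: "'l \<Rightarrow> 'l \<Rightarrow> 'l \<Rightarrow> 'l"

text \<open>The addition is a parameter, again to cover both algebras and actions.\<close>

definition leibniz_law ::
  "('c \<Rightarrow> 'c \<Rightarrow> 'c) \<Rightarrow> ('c \<Rightarrow> 'c \<Rightarrow> 'c \<Rightarrow> 'c) \<Rightarrow> 'c \<Rightarrow> 'c \<Rightarrow> 'c \<Rightarrow> 'c \<Rightarrow> 'c \<Rightarrow> bool" where
  "leibniz_law add br x y z t u \<longleftrightarrow>
     br (br x y z) t u =
     add (add (br x y (br z t u)) (br x (br y t u) z)) (br (br x t u) y z)"

definition ternary_leibniz_algebra :: "('k::field, 'l::ab_group_add) tern_alg \<Rightarrow> bool" where
  "ternary_leibniz_algebra L \<longleftrightarrow>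
     vector_space (tern_scale L) \<and>
     trilinear_map (tern_scale L) (tern_scale L) (tern_scale L) (tern_scale L) (tern_bracket L) \<and>
     (\<forall>x y z t u. leibniz_law (+) (tern_bracket L) x y z t u)"

definition tern_morphism ::
  "('k::field, 'l::ab_group_add) tern_alg \<Rightarrow> ('k, 'p::ab_group_add) tern_alg \<Rightarrow>
   ('l \<Rightarrow> 'p) \<Rightarrow> bool" where
  "tern_morphism L P f \<longleftrightarrow>
     ternary_leibniz_algebra L \<and> ternary_leibniz_algebra P \<and>
     Vector_Spaces.linear (tern_scale L) (tern_scale P) f \<and>
     (\<forall>x y z. f (tern_bracket L x y z) = tern_bracket P (f x) (f y) (f z))"

record ('l, 'p) tern_act =
  m1 :: "'l \<Rightarrow> 'p \<Rightarrow> 'p \<Rightarrow> 'l"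
  m2 :: "'p \<Rightarrow> 'l \<Rightarrow> 'p \<Rightarrow> 'l"
  m3 :: "'p \<Rightarrow> 'p \<Rightarrow> 'l \<Rightarrow> 'l"
  m1' :: "'p \<Rightarrow> 'l \<Rightarrow> 'l \<Rightarrow> 'l"
  m2' :: "'l \<Rightarrow> 'p \<Rightarrow> 'l \<Rightarrow> 'l"
  m3' :: "'l \<Rightarrow> 'l \<Rightarrow> 'p \<Rightarrow> 'l"

fun mixed_bracket ::
  "('k, 'l) tern_alg \<Rightarrow> ('k, 'p) tern_alg \<Rightarrow> ('l, 'p) tern_act \<Rightarrow>
   'l + 'p \<Rightarrow> 'l + 'p \<Rightarrow> 'l + 'p \<Rightarrow> 'l + 'p" where
  "mixed_bracket L P m (Inl x) (Inl y) (Inl z) = Inl (tern_bracket L x y z)"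
| "mixed_bracket L P m (Inr a) (Inr b) (Inr c) = Inr (tern_bracket P a b c)"
| "mixed_bracket L P m (Inl x) (Inr b) (Inr c) = Inl (m1 m x b c)"
| "mixed_bracket L P m (Inr a) (Inl y) (Inr c) = Inl (m2 m a y c)"
| "mixed_bracket L P m (Inr a) (Inr b) (Inl z) = Inl (m3 m a b z)"
| "mixed_bracket L P m (Inr a) (Inl y) (Inl z) = Inl (m1' m a y z)"
| "mixed_bracket L P m (Inl x) (Inr b) (Inl z) = Inl (m2' m x b z)"
| "mixed_bracket L P m (Inl x) (Inl y) (Inr c) = Inl (m3' m x y c)"

text \<open>
  Only sums of elements of the same algebra are meaningful. By \<open>isl_mixed_bracket\<close> below, all
  terms of the Leibniz identity lie in \<open>L\<close> as soon as one of its variables does, so the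
  last clause is never reached.
\<close>

fun mixed_add :: "'l::plus + 'p::plus \<Rightarrow> 'l + 'p \<Rightarrow> 'l + 'p" where
  "mixed_add (Inl x) (Inl y) = Inl (x + y)"
| "mixed_add (Inr a) (Inr b) = Inr (a + b)"
| "mixed_add _ _ = undefined"

lemma isl_mixed_bracket:
  "isl (mixed_bracket L P m u v w) \<longleftrightarrow> isl u \<or> isl v \<or> isl w"
  by (cases u; cases v; cases w) simp_all

text \<open>\<open>tern_action P L m\<close>: \<open>P\<close> acts on \<open>L\<close> by the six maps in \<open>m\<close>.\<close>

definition tern_action ::
  "('k::field, 'p::ab_group_add) tern_alg \<Rightarrow> ('k, 'l::ab_group_add) tern_alg \<Rightarrow>
   ('l, 'p) tern_act \<Rightarrow> bool" where
  "tern_action P L m \<longleftrightarrow>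
     ternary_leibniz_algebra P \<and> ternary_leibniz_algebra L \<and>
     trilinear_map (tern_scale L) (tern_scale P) (tern_scale P) (tern_scale L) (m1 m) \<and>
     trilinear_map (tern_scale P) (tern_scale L) (tern_scale P) (tern_scale L) (m2 m) \<and>
     trilinear_map (tern_scale P) (tern_scale P) (tern_scale L) (tern_scale L) (m3 m) \<and>
     trilinear_map (tern_scale P) (tern_scale L) (tern_scale L) (tern_scale L) (m1' m) \<and>
     trilinear_map (tern_scale L) (tern_scale P) (tern_scale L) (tern_scale L) (m2' m) \<and>
     trilinear_map (tern_scale L) (tern_scale L) (tern_scale P) (tern_scale L) (m3' m) \<and>
     (\<forall>x y z t u. not_all_same_side {x, y, z, t, u} \<longrightarrow>
        leibniz_law mixed_add (mixed_bracket L P m) x y z t u)"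

definition tern_crossed_module ::
  "('k::field, 'l::ab_group_add) tern_alg \<Rightarrow> ('k, 'p::ab_group_add) tern_alg \<Rightarrow>
   ('l, 'p) tern_act \<Rightarrow> ('l \<Rightarrow> 'p) \<Rightarrow> bool" where
  "tern_crossed_module L P m \<phi> \<longleftrightarrow>
     tern_morphism L P \<phi> \<and> tern_action P L m \<and>
     (\<forall>l p q. \<phi> (m1 m l p q) = tern_bracket P (\<phi> l) p q) \<and>
     (\<forall>p l q. \<phi> (m2 m p l q) = tern_bracket P p (\<phi> l) q) \<and>
     (\<forall>p q l. \<phi> (m3 m p q l) = tern_bracket P p q (\<phi> l)) \<and>
     (\<forall>p k l. \<phi> (m1' m p k l) = tern_bracket P p (\<phi> k) (\<phi> l)) \<and>
     (\<forall>k p l. \<phi> (m2' m k p l) = tern_bracket P (\<phi> k) p (\<phi> l)) \<and>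
     (\<forall>k l p. \<phi> (m3' m k l p) = tern_bracket P (\<phi> k) (\<phi> l) p) \<and>
     (\<forall>x y z. tern_bracket L x y z = m1' m (\<phi> x) y z \<and>
              m1' m (\<phi> x) y z = m2' m x (\<phi> y) z \<and>
              m2' m x (\<phi> y) z = m3' m x y (\<phi> z)) \<and>
     (\<forall>x y z. m3 m (\<phi> x) (\<phi> y) z = m2 m (\<phi> x) y (\<phi> z) \<and>
              m2 m (\<phi> x) y (\<phi> z) = m1 m x (\<phi> y) (\<phi> z)) \<and>
     (\<forall>k l p. m3' m k l p = m2 m (\<phi> k) l p \<and> m2 m (\<phi> k) l p = m1 m k (\<phi> l) p) \<and>
     (\<forall>k p l. m2' m k p l = m3 m (\<phi> k) p l \<and> m3 m (\<phi> k) p l = m1 m k p (\<phi> l)) \<and>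
     (\<forall>p k l. m1' m p k l = m3 m p (\<phi> k) l \<and> m3 m p (\<phi> k) l = m2 m p k (\<phi> l))"

definition tern_crossed_morphism ::
  "('k::field, 'l::ab_group_add) tern_alg \<Rightarrow> ('k, 'p::ab_group_add) tern_alg \<Rightarrow>
   ('l, 'p) tern_act \<Rightarrow> ('l \<Rightarrow> 'p) \<Rightarrow>
   ('k, 'c::ab_group_add) tern_alg \<Rightarrow> ('k, 'd::ab_group_add) tern_alg \<Rightarrow>
   ('c, 'd) tern_act \<Rightarrow> ('c \<Rightarrow> 'd) \<Rightarrow> ('l \<Rightarrow> 'c) \<Rightarrow> ('p \<Rightarrow> 'd) \<Rightarrow> bool" where
  "tern_crossed_morphism L P m \<phi> L' P' n \<phi>' \<alpha> \<beta> \<longleftrightarrow>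
     tern_crossed_module L P m \<phi> \<and> tern_crossed_module L' P' n \<phi>' \<and>
     tern_morphism L L' \<alpha> \<and> tern_morphism P P' \<beta> \<and>
     (\<forall>l. \<phi>' (\<alpha> l) = \<beta> (\<phi> l)) \<and>
     (\<forall>l p q. \<alpha> (m1 m l p q) = m1 n (\<alpha> l) (\<beta> p) (\<beta> q)) \<and>
     (\<forall>p l q. \<alpha> (m2 m p l q) = m2 n (\<beta> p) (\<alpha> l) (\<beta> q)) \<and>
     (\<forall>p q l. \<alpha> (m3 m p q l) = m3 n (\<beta> p) (\<beta> q) (\<alpha> l)) \<and>
     (\<forall>p k l. \<alpha> (m1' m p k l) = m1' n (\<beta> p) (\<alpha> k) (\<alpha> l)) \<and>
     (\<forall>k p l. \<alpha> (m2' m k p l) = m2' n (\<alpha> k) (\<beta> p) (\<alpha> l)) \<and>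
     (\<forall>k l p. \<alpha> (m3' m k l p) = m3' n (\<alpha> k) (\<alpha> l) (\<beta> p))"


section \<open>From triassociative to ternary Leibniz\<close>

definition T :: "('k, 'a::ab_group_add) tri_alg \<Rightarrow> ('k, 'a) tern_alg" where
  "T A = \<lparr>tern_scale = tri_scale A,
          tern_bracket = (\<lambda>x y z.
            let w = tri_prod A Perp y z - tri_prod A Perp z y
            in tri_prod A Dashv x w - tri_prod A Vdash w x)\<rparr>"

definition T_act ::
  "('k, 'a::ab_group_add) tri_alg \<Rightarrow> ('k, 'b::ab_group_add) tri_alg \<Rightarrow>
   ('a, 'b) tri_act \<Rightarrow> ('a, 'b) tern_act" where
  "T_act A B \<mu> =
     \<lparr>m1 = (\<lambda>x a b. let w = tri_prod B Perp a b - tri_prod B Perp b a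
                    in mu1 \<mu> Dashv x w - mu2 \<mu> Vdash w x),
      m2 = (\<lambda>a x b. let w = mu1 \<mu> Perp x b - mu2 \<mu> Perp b x
                    in mu2 \<mu> Dashv a w - mu1 \<mu> Vdash w a),
      m3 = (\<lambda>a b x. let w = mu2 \<mu> Perp b x - mu1 \<mu> Perp x b
                    in mu2 \<mu> Dashv a w - mu1 \<mu> Vdash w a),
      m1' = (\<lambda>c y z. let w = tri_prod A Perp y z - tri_prod A Perp z y
                     in mu2 \<mu> Dashv c w - mu1 \<mu> Vdash w c),
      m2' = (\<lambda>y c z. let w = mu2 \<mu> Perp c z - mu1 \<mu> Perp z c
                     in tri_prod A Dashv y w - tri_prod A Vdash w y),
      m3' = (\<lambda>y z c. let w = mu1 \<mu> Perp z c - mu2 \<mu> Perp c z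
                     in tri_prod A Dashv y w - tri_prod A Vdash w y)\<rparr>"

end

theory Submission
  imports Defs "HOL-Library.Product_Plus"
begin

text \<open>
  Write \<open>D w x = x \<stileturn> w - w \<turnstile> x\<close>. The eleven axioms make each \<open>D w\<close> a derivation of all three products,
  and \<open>[x, y, z] = D (y \<bottom> z - z \<bottom> y) x\<close>, so the ternary Leibniz identity says that
  \<open>D (t \<bottom> u - u \<bottom> t)\<close> is a derivation. For the action identities, the same
  argument is applied to the semidirect product on \<open>A \<times> B\<close>, into which the disjoint sum \<open>A + B\<close> with
  its mixed products embeds. The crossed module conditions follow by moving
  \<open>\<phi>\<close> through the products.
\<close>

section \<open>The Leibniz identity\<close>

text \<open>Additivity is all the Leibniz identity uses, so the semidirect product below gets by
  without a scalar multiplication.\<close>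

locale triassociative_product =
  fixes p :: "tri_op \<Rightarrow> 'c::ab_group_add \<Rightarrow> 'c \<Rightarrow> 'c"
  assumes add_left: "p s (x + y) z = p s x z + p s y z"
    and add_right: "p s x (y + z) = p s x y + p s x z"
    and laws: "tri_laws p x y z"
begin

lemma diff_left: "p s (x - y) z = p s x z - p s y z"
  using add_left[of s "x - y" y z] by (simp add: algebra_simps)

lemma diff_right: "p s x (y - z) = p s x y - p s x z"
  using add_right[of s x "y - z" z] by (simp add: algebra_simps)

definition D :: "'c \<Rightarrow> 'c \<Rightarrow> 'c" where
  "D w x = p Dashv x w - p Vdash w x"

lemma Dashv_right:
  "p Dashv x (p Vdash y z) = p Dashv x (p Dashv y z)"
  using laws[of x y z] unfolding tri_laws_def by metis

text \<open>On the right, the terms with \<open>w\<close> in the middle,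
  \<open>p s (p Dashv x w) y\<close> and \<open>p s x (p Vdash w y)\<close>, cancel by the laws at
  \<open>x w y\<close>. The laws at \<open>w x y\<close> and \<open>x y w\<close> turn the other two
  into the left side.\<close>

lemma D_derivation: "D w (p s x y) = p s (D w x) y + p s x (D w y)"
  using laws[of w x y] laws[of x w y] laws[of x y w]
  by (cases s) (simp_all add: D_def tri_laws_def diff_left diff_right Dashv_right)

lemma D_add_left: "D (v + w) x = D v x + D w x"
  by (simp add: D_def add_left add_right)

lemma D_diff_right: "D w (x - y) = D w x - D w y"
  by (simp add: D_def diff_left diff_right)

lemma D_D: "D v (D w x) = D (D v w) x + D w (D v x)"
proof -
  \<comment> \<open>Only the inner \<open>D\<close> is unfolded: the outer \<open>D v\<close> must
    survive to act as a derivation on the two products.\<close>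
  have "D v (D w x) = D v (p Dashv x w) - D v (p Vdash w x)"
    by (simp only: D_def[of w x] D_diff_right)
  then show ?thesis
    by (simp add: D_derivation D_def[of "D v w"] D_def[of w "D v x"])
qed

end

definition tri_bracket :: "(tri_op \<Rightarrow> 'c::ab_group_add \<Rightarrow> 'c \<Rightarrow> 'c) \<Rightarrow> 'c \<Rightarrow> 'c \<Rightarrow> 'c \<Rightarrow> 'c" where
  "tri_bracket p x y z =
     p Dashv x (p Perp y z - p Perp z y) - p Vdash (p Perp y z - p Perp z y) x"

lemma tern_bracket_T: "tern_bracket (T A) = tri_bracket (tri_prod A)"
  by (simp add: fun_eq_iff T_def tri_bracket_def Let_def)

text \<open>With \<open>w = c t u\<close>, \<open>D_D\<close> turns the left side into
  \<open>D (D w (c y z)) x + D (c y z) (D w x)\<close>. Since \<open>D w\<close> is a derivation of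
  the commutator \<open>c\<close>, the first term splits into the other two brackets.\<close>

lemma (in triassociative_product) leibniz_law_tri_bracket:
  "leibniz_law (+) (tri_bracket p) x y z t u"
proof -
  define c where "c y z = p Perp y z - p Perp z y" for y z
  have br: "tri_bracket p x y z = D (c y z) x" for x y z
    by (simp add: tri_bracket_def D_def c_def)
  have "D w (c y z) = c (D w y) z + c y (D w z)" for w
    by (simp add: c_def D_diff_right D_derivation)
  then show ?thesis
    by (simp add: leibniz_law_def br D_D[of "c t u" "c y z"] D_add_left)
qed

section \<open>The semidirect product\<close>

fun semidirect_prod ::
  "('k, 'a::ab_group_add) tri_alg \<Rightarrow> ('k, 'b::ab_group_add) tri_alg \<Rightarrow> ('a, 'b) tri_act \<Rightarrow>
   tri_op \<Rightarrow> 'a \<times> 'b \<Rightarrow> 'a \<times> 'b \<Rightarrow> 'a \<times> 'b" where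
  "semidirect_prod A B \<mu> s (x, a) (y, b) =
     (tri_prod A s x y + mu1 \<mu> s x b + mu2 \<mu> s a y, tri_prod B s a b)"

fun sum_embed :: "'a::zero + 'b::zero \<Rightarrow> 'a \<times> 'b" where
  "sum_embed (Inl x) = (x, 0)"
| "sum_embed (Inr a) = (0, a)"

text \<open>The side has to be prescribed because \<open>Inl 0\<close> and \<open>Inr 0\<close> have
  the same image.\<close>

lemma sum_embed_inject:
  "sum_embed u = sum_embed v \<Longrightarrow> isl u = isl v \<Longrightarrow> u = v"
  by (cases u; cases v) auto

lemma sum_embed_mixed_add:
  fixes u v :: "'a::ab_group_add + 'b::ab_group_add"
  shows "isl u = isl v \<Longrightarrow> sum_embed (mixed_add u v) = sum_embed u + sum_embed v"
  by (cases u; cases v) auto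

lemma isl_mixed_add: "isl u \<Longrightarrow> isl v \<Longrightarrow> isl (mixed_add u v)"
  by (cases u; cases v) auto

lemma bilinear_map_add_left: "bilinear_map s1 s2 s f \<Longrightarrow> f (x + y) z = f x z + f y z"
  by (auto simp: bilinear_map_def intro: module_hom.add[OF module_hom_linearI])

lemma bilinear_map_add_right: "bilinear_map s1 s2 s f \<Longrightarrow> f z (x + y) = f z x + f z y"
  by (auto simp: bilinear_map_def intro: module_hom.add[OF module_hom_linearI])

lemma bilinear_map_0_left: "bilinear_map s1 s2 s f \<Longrightarrow> f 0 z = 0"
  using bilinear_map_add_left[of s1 s2 s f 0 0 z] by simp

lemma bilinear_map_0_right: "bilinear_map s1 s2 s f \<Longrightarrow> f z 0 = 0"
  using bilinear_map_add_right[of s1 s2 s f z 0 0] by simp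

text \<open>Both sides of each law are additive in every variable; this carries the laws from
  generators to sums.\<close>

lemma tri_laws_add:
  assumes "\<And>s x y z. p s (x + y) z = p s x z + p s y z"
    and "\<And>s x y z. p s x (y + z) = p s x y + p s x z"
  shows "tri_laws p x y z \<Longrightarrow> tri_laws p x' y z \<Longrightarrow> tri_laws p (x + x') y z"
    and "tri_laws p x y z \<Longrightarrow> tri_laws p x y' z \<Longrightarrow> tri_laws p x (y + y') z"
    and "tri_laws p x y z \<Longrightarrow> tri_laws p x y z' \<Longrightarrow> tri_laws p x y (z + z')"
  unfolding tri_laws_def assms by metis+

lemma tri_laws_hom:
  assumes "\<And>s u v. f (p s u v) = q s (f u) (f v)" and "tri_laws p u v w"
  shows "tri_laws q (f u) (f v) (f w)"
  using assms(2) unfolding tri_laws_def assms(1)[symmetric] by metis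

context
  fixes A :: "('k::field, 'a::ab_group_add) tri_alg"
    and B :: "('k, 'b::ab_group_add) tri_alg"
    and \<mu> :: "('a, 'b) tri_act"
  assumes act: "tri_action B A \<mu>"
begin

lemma bilinear_action:
  "bilinear_map (tri_scale A) (tri_scale A) (tri_scale A) (tri_prod A s)"
  "bilinear_map (tri_scale B) (tri_scale B) (tri_scale B) (tri_prod B s)"
  "bilinear_map (tri_scale A) (tri_scale B) (tri_scale A) (mu1 \<mu> s)"
  "bilinear_map (tri_scale B) (tri_scale A) (tri_scale A) (mu2 \<mu> s)"
  using act by (simp_all add: tri_action_def triassociative_algebra_def)

lemmas action_simps =
  bilinear_action[THEN bilinear_map_0_left] bilinear_action[THEN bilinear_map_0_right]
  bilinear_action[THEN bilinear_map_add_left] bilinear_action[THEN bilinear_map_add_right]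

lemma sum_embed_mixed_prod:
  "sum_embed (mixed_prod A B \<mu> s u v) = semidirect_prod A B \<mu> s (sum_embed u) (sum_embed v)"
  by (cases u; cases v) (simp_all add: action_simps)

text \<open>The action axioms cover the mixed triples; pure triples are transported from
  \<open>A\<close> and \<open>B\<close> along \<open>Inl\<close> and \<open>Inr\<close>.\<close>

lemma tri_laws_mixed_prod: "tri_laws (mixed_prod A B \<mu>) u v w"
proof (cases "not_all_same_side {u, v, w}")
  case True
  then show ?thesis
    using act by (simp add: tri_action_def)
next
  case False
  have "tri_laws (tri_prod A) x y z" "tri_laws (tri_prod B) a b c" for x y z a b c
    using act by (simp_all add: tri_action_def triassociative_algebra_def)
  then have "tri_laws (mixed_prod A B \<mu>) (Inl x) (Inl y) (Inl z)"
    "tri_laws (mixed_prod A B \<mu>) (Inr a) (Inr b) (Inr c)" for x y z a b c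
    by (auto intro!: tri_laws_hom[where f = Inl] tri_laws_hom[where f = Inr])
  with False show ?thesis
    by (cases u; cases v; cases w) (auto simp: not_all_same_side_def)
qed

lemma triassociative_semidirect_prod: "triassociative_product (semidirect_prod A B \<mu>)"
proof
  let ?p = "semidirect_prod A B \<mu>"
  show l: "?p s (x + y) z = ?p s x z + ?p s y z" for s x y z
    by (cases x; cases y; cases z) (simp add: action_simps algebra_simps)
  show r: "?p s x (y + z) = ?p s x y + ?p s x z" for s x y z
    by (cases x; cases y; cases z) (simp add: action_simps algebra_simps)
  fix x y z :: "'a \<times> 'b"
  have laws: "tri_laws ?p (sum_embed u) (sum_embed v) (sum_embed w)" for u v w
    using sum_embed_mixed_prod tri_laws_mixed_prod by (rule tri_laws_hom)
  \<comment> \<open>The decomposition is \<open>(x, a) = (x, 0) + (0, a)\<close>.\<close>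
  have e: "\<exists>u v. w = sum_embed u + sum_embed v" for w :: "'a \<times> 'b"
    by (metis add_Pair add_0 add.right_neutral sum_embed.simps surj_pair)
  obtain u u' where "x = sum_embed u + sum_embed u'"
    using e by blast
  moreover obtain v v' where "y = sum_embed v + sum_embed v'"
    using e by blast
  moreover obtain w w' where "z = sum_embed w + sum_embed w'"
    using e by blast
  ultimately show "tri_laws ?p x y z"
    by (simp only:) (intro tri_laws_add[OF l r] laws)
qed

text \<open>The six maps of \<open>T_act\<close> are the restrictions of one bracket on the
  semidirect product to arguments from \<open>A\<close> or \<open>B\<close>; products with a zero
  component vanish.\<close>

lemma sum_embed_mixed_bracket:
  "sum_embed (mixed_bracket (T A) (T B) (T_act A B \<mu>) u v w) =
   tri_bracket (semidirect_prod A B \<mu>) (sum_embed u) (sum_embed v) (sum_embed w)"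
  by (cases u; cases v; cases w)
    (simp_all add: tri_bracket_def T_def T_act_def Let_def action_simps)

lemma leibniz_law_mixed_bracket:
  assumes "not_all_same_side {x, y, z, t, u}"
  shows "leibniz_law mixed_add (mixed_bracket (T A) (T B) (T_act A B \<mu>)) x y z t u"
proof -
  let ?br = "mixed_bracket (T A) (T B) (T_act A B \<mu>)"
  have l: "isl x \<or> isl y \<or> isl z \<or> isl t \<or> isl u"
    using assms by (auto simp: not_all_same_side_def)
  let ?P = "?br x y (?br z t u)" and ?Q = "?br x (?br y t u) z" and ?R = "?br (?br x t u) y z"
  \<comment> \<open>One variable in \<open>A\<close> puts every term in \<open>A\<close>, so
    \<open>mixed_add\<close> is a genuine sum and the identity can be pulled back along
    \<open>sum_embed\<close>.\<close>
  have isl: "isl ?P" "isl ?Q" "isl ?R" "isl (?br (?br x y z) t u)"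
    using l by (auto simp: isl_mixed_bracket)
  have "sum_embed (?br (?br x y z) t u) = sum_embed (mixed_add (mixed_add ?P ?Q) ?R)"
    using triassociative_product.leibniz_law_tri_bracket[OF triassociative_semidirect_prod,
        of "sum_embed x" "sum_embed y" "sum_embed z" "sum_embed t" "sum_embed u"]
    by (simp add: sum_embed_mixed_add isl isl_mixed_add sum_embed_mixed_bracket leibniz_law_def)
  then show ?thesis
    unfolding leibniz_law_def by (rule sum_embed_inject) (simp add: isl isl_mixed_add)
qed

end

section \<open>Multilinearity\<close>

lemma linear_diff_fun:
  assumes "Vector_Spaces.linear s1 s2 f" "Vector_Spaces.linear s1 s2 g"
  shows "Vector_Spaces.linear s1 s2 (\<lambda>x. f x - g x)"
proof -
  interpret vector_space_pair s1 s2
    using assms(1) by (simp add: Vector_Spaces.linear_def vector_space_pair_def)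
  show ?thesis
    using assms by (rule linear_compose_sub)
qed

lemma bilinear_map_commutator:
  "bilinear_map s1 s2 s f \<Longrightarrow> bilinear_map s2 s1 s g \<Longrightarrow>
   bilinear_map s1 s2 s (\<lambda>x y. f x y - g y x)"
  by (simp add: bilinear_map_def linear_diff_fun)

lemma trilinear_map_comp:
  assumes "bilinear_map s1 s2 s f" "bilinear_map s3 s4 s2 g"
  shows "trilinear_map s1 s3 s4 s (\<lambda>x y z. f x (g y z))"
  using assms
  by (auto simp: bilinear_map_def trilinear_map_def
      intro: Vector_Spaces.linear_compose[unfolded o_def, of _ s2])

text \<open>The bracket of \<open>T\<close> and the six action maps all have the shape
  \<open>f x w - g w x\<close> with \<open>w = h y z - k z y\<close>, where \<open>f\<close>,
  \<open>g\<close>, \<open>h\<close>, \<open>k\<close> are bilinear.\<close>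

lemmas trilinear_map_bracket =
  trilinear_map_comp[OF bilinear_map_commutator bilinear_map_commutator]

lemma tern_scale_T [simp]: "tern_scale (T A) = tri_scale A"
  by (simp add: T_def)

section \<open>Algebras, actions and crossed modules\<close>

lemma ternary_leibniz_algebra_T:
  assumes "triassociative_algebra A"
  shows "ternary_leibniz_algebra (T A)"
proof -
  have bil: "bilinear_map (tri_scale A) (tri_scale A) (tri_scale A) (tri_prod A s)" for s
    using assms by (simp add: triassociative_algebra_def)
  interpret triassociative_product "tri_prod A"
    using assms bil[THEN bilinear_map_add_left] bil[THEN bilinear_map_add_right]
    by (simp add: triassociative_product_def triassociative_algebra_def)
  show ?thesis
    using assms trilinear_map_bracket[OF bil bil bil bil] leibniz_law_tri_bracket
    by (simp add: ternary_leibniz_algebra_def triassociative_algebra_def tern_bracket_T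
        tri_bracket_def[abs_def])
qed

lemma tern_morphism_T:
  assumes "tri_morphism A B f"
  shows "tern_morphism (T A) (T B) f"
proof -
  have "f (x - y) = f x - f y" for x y
    using assms by (auto simp: tri_morphism_def module_hom.diff[OF module_hom_linearI])
  then show ?thesis
    using assms
    by (simp add: tern_morphism_def tri_morphism_def ternary_leibniz_algebra_T tern_bracket_T
        tri_bracket_def)
qed

lemma tern_action_T_act:
  assumes "tri_action B A \<mu>"
  shows "tern_action (T B) (T A) (T_act A B \<mu>)"
proof -
  note bil = bilinear_action[OF assms]
  \<comment> \<open>In order: \<open>m1\<close>, \<open>m2\<close>, \<open>m3\<close>,
    \<open>m1'\<close>, \<open>m2'\<close>, \<open>m3'\<close>. The first two facts serve the outer
    \<open>Dashv\<close> and \<open>Vdash\<close>, the last two the inner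
    \<open>Perp\<close>.\<close>
  note tri = trilinear_map_bracket[OF bil(3) bil(4) bil(2) bil(2)]
    trilinear_map_bracket[OF bil(4) bil(3) bil(3) bil(4)]
    trilinear_map_bracket[OF bil(4) bil(3) bil(4) bil(3)]
    trilinear_map_bracket[OF bil(4) bil(3) bil(1) bil(1)]
    trilinear_map_bracket[OF bil(1) bil(1) bil(4) bil(3)]
    trilinear_map_bracket[OF bil(1) bil(1) bil(3) bil(4)]
  have "ternary_leibniz_algebra (T A)" "ternary_leibniz_algebra (T B)"
    using assms by (simp_all add: tri_action_def ternary_leibniz_algebra_T)
  then show ?thesis
    by (simp add: tern_action_def leibniz_law_mixed_bracket[OF assms])
      (simp add: T_act_def Let_def tri)
qed

lemma tern_crossed_module_T:
  assumes "tri_crossed_module A B \<mu> \<phi>"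
  shows "tern_crossed_module (T A) (T B) (T_act A B \<mu>) \<phi>"
proof -
  have "tern_morphism (T A) (T B) \<phi>" "tern_action (T B) (T A) (T_act A B \<mu>)"
    using assms by (simp_all add: tri_crossed_module_def tern_morphism_T tern_action_T_act)
  \<comment> \<open>These equations are oriented to move \<open>\<phi>\<close> outwards or absorb it
    into a product of \<open>A\<close>, which brings both sides of each condition to the same
    form.\<close>
  moreover have "\<phi> x - \<phi> y = \<phi> (x - y)" for x y
    using assms by (auto simp: tri_crossed_module_def tri_morphism_def
        module_hom.diff[OF module_hom_linearI])
  moreover have "tri_prod B s (\<phi> x) a = \<phi> (mu1 \<mu> s x a)"
    "tri_prod B s a (\<phi> x) = \<phi> (mu2 \<mu> s a x)"
    "mu1 \<mu> s x (\<phi> y) = tri_prod A s x y" "mu2 \<mu> s (\<phi> x) y = tri_prod A s x y" for s x y a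
    using assms by (simp_all add: tri_crossed_module_def)
  ultimately show ?thesis
    by (simp add: tern_crossed_module_def T_act_def T_def Let_def)
qed

lemma tern_crossed_morphism_T:
  assumes "tri_crossed_morphism A B \<mu> \<phi> A' B' \<mu>' \<phi>' \<alpha> \<beta>"
  shows "tern_crossed_morphism (T A) (T B) (T_act A B \<mu>) \<phi> (T A') (T B') (T_act A' B' \<mu>') \<phi>' \<alpha> \<beta>"
proof -
  have \<alpha>: "tri_morphism A A' \<alpha>" and \<beta>: "tri_morphism B B' \<beta>"
    using assms by (simp_all add: tri_crossed_morphism_def)
  \<comment> \<open>Here \<open>\<alpha>\<close> and \<open>\<beta>\<close> are pushed inwards to
    the variables instead, which yields the formulas of the primed action.\<close>
  then have "\<alpha> (x - y) = \<alpha> x - \<alpha> y" "\<beta> (a - b) = \<beta> a - \<beta> b"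
    "\<alpha> (tri_prod A s x y) = tri_prod A' s (\<alpha> x) (\<alpha> y)"
    "\<beta> (tri_prod B s a b) = tri_prod B' s (\<beta> a) (\<beta> b)" for s x y a b
    by (auto simp: tri_morphism_def module_hom.diff[OF module_hom_linearI])
  moreover have "tern_crossed_module (T A) (T B) (T_act A B \<mu>) \<phi>"
    "tern_crossed_module (T A') (T B') (T_act A' B' \<mu>') \<phi>'"
    using assms by (simp_all add: tri_crossed_morphism_def tern_crossed_module_T)
  moreover have "\<phi>' (\<alpha> x) = \<beta> (\<phi> x)" "\<alpha> (mu1 \<mu> s x a) = mu1 \<mu>' s (\<alpha> x) (\<beta> a)"
    "\<alpha> (mu2 \<mu> s a x) = mu2 \<mu>' s (\<beta> a) (\<alpha> x)" for s x a
    using assms by (simp_all add: tri_crossed_morphism_def)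
  ultimately show ?thesis
    using \<alpha> \<beta> by (simp add: tern_crossed_morphism_def tern_morphism_T)
      (simp add: T_act_def Let_def)
qed

theorem theorem3p1:
  fixes A :: "('k::field, 'a::ab_group_add) tri_alg"
    and B :: "('k, 'b::ab_group_add) tri_alg"
    and \<mu> :: "('a, 'b) tri_act"
    and \<phi> :: "'a \<Rightarrow> 'b"
  assumes "tri_crossed_module A B \<mu> \<phi>"
  shows "tern_action (T B) (T A) (T_act A B \<mu>) \<and>
         tern_crossed_module (T A) (T B) (T_act A B \<mu>) \<phi> \<and>
         (\<forall>(A' :: ('k, 'c::ab_group_add) tri_alg) (B' :: ('k, 'd::ab_group_add) tri_alg)
            (\<mu>' :: ('c, 'd) tri_act) (\<phi>' :: 'c \<Rightarrow> 'd) (\<alpha> :: 'a \<Rightarrow> 'c) (\<beta> :: 'b \<Rightarrow> 'd).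
            tri_crossed_module A' B' \<mu>' \<phi>' \<and>
            tri_crossed_morphism A B \<mu> \<phi> A' B' \<mu>' \<phi>' \<alpha> \<beta> \<longrightarrow>
            tern_crossed_morphism (T A) (T B) (T_act A B \<mu>) \<phi>
              (T A') (T B') (T_act A' B' \<mu>') \<phi>' \<alpha> \<beta>)"
proof (intro conjI allI impI)
  show "tern_action (T B) (T A) (T_act A B \<mu>)"
    using assms by (simp add: tri_crossed_module_def tern_action_T_act)
  show "tern_crossed_module (T A) (T B) (T_act A B \<mu>) \<phi>"
    using assms by (rule tern_crossed_module_T)
qed (elim conjE, rule tern_crossed_morphism_T)

end
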